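(* Let $(X,d)$ be a compact metric space and $f_{1,\infty}=\{f_i\}_{i=1}^\infty$ an equicontinuous sequence of maps from $X$ to itself. Then for any $Z\subseteq X$, $\theta\in[0,1]$ and $m\in\mathbb N$, \[ \underline{h}_{\mathrm{top}}(f_{1,\infty}^m,Z,\theta)=m\,\underline{h}_{\mathrm{top}}(f_{1,\infty},Z,\theta),\qquad \overline{h}_{\mathrm{top}}(f_{1,\infty}^m,Z,\theta)=m\,\overline{h}_{\mathrm{top}}(f_{1,\infty},Z,\theta), \] where $f_{1,\infty}^m=\{f_{im+1}^m\}_{i=0}^\infty$, with $f_{im+1}^m=f_{im+m}\circ\cdots\circ f_{im+2}\circ f_{im+1}$.
   Context: Intermediate topological entropies. Let $X$ be a compact topological space and $f_{1,\infty}=\{f_i\}_{i=1}^\infty$ a sequence of continuous maps $X\to X$. Put $f_i^0=\mathrm{id}_X$ and $f_i^j=f_{i+j-1}\circ\cdots\circ f_{i+1}\circ f_i$ for $j\ge1$. For a finite open cover $\mathcal U$ of $X$ and $m\in\mathbb N=\{1,2,\dots\}$, a string of length $m(\mathbf U)=m$ is an element $\mathbf U=(U_0,\dots,U_{m-1})\in\mathcal S_m(\mathcal U):=\mathcal U^m$, and $X(\mathbf U)=\{x\in X: f_1^j(x)\in U_j,\ 0\le j\le m-1\}$. For $Z\subseteq X$, $\alpha\ge0$, $\theta\in[0,1]$, $N\in\mathbb N$ let \[ M(Z,\alpha,\mathcal U,N,\theta)=\inf_{\mathcal G}\sum_{\mathbf U\in\mathcal G}e^{-\alpha m(\mathbf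 U)}, \] the infimum over all finite or countable collections $\mathcal G\subseteq\bigcup_{N\le m<N/\theta+1}\mathcal S_m(\mathcal U)$ with $Z\subseteq\bigcup_{\mathbf U\in\mathcal G}X(\mathbf U)$ (for $\theta=0$, $N/\theta=+\infty$). Let $\underline m(Z,\alpha,\mathcal U,\theta)=\liminf_{N\to\infty}M(Z,\alpha,\mathcal U,N,\theta)$ and $\overline m(Z,\alpha,\mathcal U,\theta)=\limsup_{N\to\infty}M(Z,\alpha,\mathcal U,N,\theta)$. Set $\underline h_{\mathrm{top}}(f_{1,\infty},Z,\mathcal U,\theta)=\inf\{\alpha\ge0:\underline m(Z,\alpha,\mathcal U,\theta)=0\}$, $\overline h_{\mathrm{top}}(f_{1,\infty},Z,\mathcal U,\theta)=\inf\{\alpha\ge0:\overline m(Z,\alpha,\mathcal U,\theta)=0\}$. The lower and upper $\theta$-intermediate topological entropies $\underline h_{\mathrm{top}}(f_{1,\infty},Z,\theta)$ and $\overline h_{\mathrm{top}}(f_{1,\infty},Z,\theta)$, with values in $[0,\infty]$, are the suprema of these quantities over all finite open covers $\mathcal U$ of $X$. The entropies of $f_{1,\infty}^m$ are those of the sequence of maps $f_1^m, f_{m+1}^m, f_{2m+1}^m,\dots$, defined in the same way. Equicontinuity: for each $\varepsilon>0$ there is $\delta>0$ such that $d(x,y)<\delta$ implies $d(f_i(x),f_i(y))<\varepsilon$ for all $i\ge1$. *)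

theory Defs
  imports "HOL-Analysis.Analysis"
begin

text \<open>
  The space \<open>X\<close> is the whole type \<open>'a\<close>. A sequence \<open>f\<^sub>1, f\<^sub>2, \<dots>\<close> of self-maps is a function
  \<open>f :: nat \<Rightarrow> 'a \<Rightarrow> 'a\<close> whose value at index \<open>0\<close> is never used.
\<close>

text \<open>\<open>comp_iter f i j\<close> is \<open>f\<^sub>i\<^sup>j\<close>, the composition of \<open>f\<^sub>i, \<dots>, f\<^bsub>i+j-1\<^esub>\<close> with \<open>f\<^sub>i\<close> applied first.\<close>

primrec comp_iter :: "(nat \<Rightarrow> 'a \<Rightarrow> 'a) \<Rightarrow> nat \<Rightarrow> nat \<Rightarrow> 'a \<Rightarrow> 'a" where
  "comp_iter f i 0 = id"
| "comp_iter f i (Suc j) = f (i + j) \<circ> comp_iter f i j"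

text \<open>The sequence \<open>f\<^sub>1\<^sup>m, f\<^bsub>m+1\<^esub>\<^sup>m, f\<^bsub>2m+1\<^esub>\<^sup>m, \<dots>\<close>, again indexed from \<open>1\<close>.\<close>

definition power_seq :: "(nat \<Rightarrow> 'a \<Rightarrow> 'a) \<Rightarrow> nat \<Rightarrow> nat \<Rightarrow> 'a \<Rightarrow> 'a" where
  "power_seq f m i = comp_iter f ((i - 1) * m + 1) m"

definition equicontinuous_seq :: "(nat \<Rightarrow> 'a::metric_space \<Rightarrow> 'a) \<Rightarrow> bool" where
  "equicontinuous_seq f \<longleftrightarrow>
     (\<forall>\<epsilon>>0. \<exists>\<delta>>0. \<forall>x y. dist x y < \<delta> \<longrightarrow> (\<forall>i\<ge>1. dist (f i x) (f i y) < \<epsilon>))"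

definition finite_open_cover :: "'a::topological_space set set \<Rightarrow> bool" where
  "finite_open_cover \<U> \<longleftrightarrow> finite \<U> \<and> (\<forall>U\<in>\<U>. open U) \<and> \<Union>\<U> = UNIV"

definition strings :: "'a set set \<Rightarrow> nat \<Rightarrow> 'a set list set" where
  "strings \<U> m = {\<s>. length \<s> = m \<and> set \<s> \<subseteq> \<U>}"

definition string_set :: "(nat \<Rightarrow> 'a \<Rightarrow> 'a) \<Rightarrow> 'a set list \<Rightarrow> 'a set" where
  "string_set f \<s> = {x. \<forall>j<length \<s>. comp_iter f 1 j x \<in> \<s> ! j}"

text \<open>
  The admissible lengths \<open>N \<le> m < N/\<theta> + 1\<close>. The case \<open>\<theta> = 0\<close>, where \<open>N/\<theta> = \<infinity>\<close>, is separate
  because division by zero yields zero in HOL.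
\<close>

definition admissible_lengths :: "nat \<Rightarrow> real \<Rightarrow> nat set" where
  "admissible_lengths N \<theta> = {m. N \<le> m \<and> (\<theta> = 0 \<or> real m < real N / \<theta> + 1)}"

definition string_covers ::
  "(nat \<Rightarrow> 'a \<Rightarrow> 'a) \<Rightarrow> 'a set \<Rightarrow> 'a set set \<Rightarrow> nat \<Rightarrow> real \<Rightarrow> 'a set list set set" where
  "string_covers f Z \<U> N \<theta> =
     {\<G>. countable \<G> \<and> \<G> \<subseteq> (\<Union>m\<in>admissible_lengths N \<theta>. strings \<U> m)
        \<and> Z \<subseteq> (\<Union>\<s>\<in>\<G>. string_set f \<s>)}"

definition M_theta ::
  "(nat \<Rightarrow> 'a \<Rightarrow> 'a) \<Rightarrow> 'a set \<Rightarrow> real \<Rightarrow> 'a set set \<Rightarrow> nat \<Rightarrow> real \<Rightarrow> ennreal" where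
  "M_theta f Z \<alpha> \<U> N \<theta> =
     (INF \<G>\<in>string_covers f Z \<U> N \<theta>. \<Sum>\<^sub>\<infinity>\<s>\<in>\<G>. ennreal (exp (- \<alpha> * real (length \<s>))))"

definition lower_m ::
  "(nat \<Rightarrow> 'a \<Rightarrow> 'a) \<Rightarrow> 'a set \<Rightarrow> real \<Rightarrow> 'a set set \<Rightarrow> real \<Rightarrow> ennreal" where
  "lower_m f Z \<alpha> \<U> \<theta> = liminf (\<lambda>N. M_theta f Z \<alpha> \<U> N \<theta>)"

definition upper_m ::
  "(nat \<Rightarrow> 'a \<Rightarrow> 'a) \<Rightarrow> 'a set \<Rightarrow> real \<Rightarrow> 'a set set \<Rightarrow> real \<Rightarrow> ennreal" where
  "upper_m f Z \<alpha> \<U> \<theta> = limsup (\<lambda>N. M_theta f Z \<alpha> \<U> N \<theta>)"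

definition lower_h_cover ::
  "(nat \<Rightarrow> 'a \<Rightarrow> 'a) \<Rightarrow> 'a set \<Rightarrow> 'a set set \<Rightarrow> real \<Rightarrow> ennreal" where
  "lower_h_cover f Z \<U> \<theta> = (INF \<alpha>\<in>{\<alpha>. 0 \<le> \<alpha> \<and> lower_m f Z \<alpha> \<U> \<theta> = 0}. ennreal \<alpha>)"

definition upper_h_cover ::
  "(nat \<Rightarrow> 'a \<Rightarrow> 'a) \<Rightarrow> 'a set \<Rightarrow> 'a set set \<Rightarrow> real \<Rightarrow> ennreal" where
  "upper_h_cover f Z \<U> \<theta> = (INF \<alpha>\<in>{\<alpha>. 0 \<le> \<alpha> \<and> upper_m f Z \<alpha> \<U> \<theta> = 0}. ennreal \<alpha>)"

definition lower_h_top ::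
  "(nat \<Rightarrow> 'a::topological_space \<Rightarrow> 'a) \<Rightarrow> 'a set \<Rightarrow> real \<Rightarrow> ennreal" where
  "lower_h_top f Z \<theta> = (SUP \<U>\<in>{\<U>. finite_open_cover \<U>}. lower_h_cover f Z \<U> \<theta>)"

definition upper_h_top ::
  "(nat \<Rightarrow> 'a::topological_space \<Rightarrow> 'a) \<Rightarrow> 'a set \<Rightarrow> real \<Rightarrow> ennreal" where
  "upper_h_top f Z \<theta> = (SUP \<U>\<in>{\<U>. finite_open_cover \<U>}. upper_h_cover f Z \<U> \<theta>)"

end

theory Submission
  imports Defs
begin

text \<open>
  Fix a finite open cover \<open>\<U>\<close>. Keeping every \<open>m\<close>-th entry of a string over \<open>\<U>\<close> turns a string for
  \<open>f\<close> of length \<open>l\<close> into one for \<open>f\<^sup>m\<close> of length \<open>\<lceil>l/m\<rceil>\<close>. Conversely, by equicontinuity there is a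
  cover \<open>\<V>\<close> by small balls whose images under the maps \<open>f\<^bsub>im+1\<^esub>\<^sup>j\<close>, \<open>j < m\<close>, all refine \<open>\<U>\<close>, so a
  string for \<open>f\<^sup>m\<close> of length \<open>n\<close> over \<open>\<V>\<close> yields a string for \<open>f\<close> of length \<open>nm\<close> over \<open>\<U>\<close>.
  The latter may be too long for the window \<open>N \<le> l < N/\<theta> + 1\<close>, but truncating it by a number of
  entries that is bounded in terms of \<open>m\<close> and \<open>\<theta>\<close> suffices, and this changes the weights only by a
  bounded factor. Both comparisons relate the parameter \<open>N\<close> for \<open>f\<close> to \<open>\<lceil>N/m\<rceil>\<close> for \<open>f\<^sup>m\<close>.
\<close>

section \<open>Iterates of the power sequence\<close>

lemma comp_iter_add:
  "comp_iter f i (j + k) = comp_iter f (i + j) k \<circ> comp_iter f i j"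
  by (induction k) (auto simp: add.assoc)

text \<open>The map with index \<open>Suc j\<close> in \<open>power_seq f m\<close> starts at index
  \<open>j * m + 1\<close> of \<open>f\<close>, exactly where the first \<open>j\<close> blocks of
  length \<open>m\<close> end, so the blocks concatenate.\<close>

lemma comp_iter_power_seq:
  "comp_iter (power_seq f m) 1 j = comp_iter f 1 (j * m)"
proof (induction j)
  case (Suc j)
  then show ?case
    using comp_iter_add[of f 1 "j * m" m] by (simp add: power_seq_def add.commute)
qed simp

section \<open>Transporting string covers and their weights\<close>

text \<open>The map \<phi> may identify elements. Keeping one preimage per image value turns the
  left-hand sum into a sum over a subset \<open>H\<close> of \<open>G\<close>, and the remaining
  terms of \<open>v\<close> are nonnegative.\<close>

lemma infsum_image_le:
  fixes w :: "'b \<Rightarrow> ennreal"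
  assumes le: "\<And>s. s \<in> G \<Longrightarrow> c * w (\<phi> s) \<le> v s"
  shows "c * infsum w (\<phi> ` G) \<le> infsum v G"
proof -
  obtain H where H: "H \<subseteq> G" "inj_on \<phi> H" "\<phi> ` G = \<phi> ` H"
    using subset_image_inj[of "\<phi> ` G" \<phi> G] by auto
  have "c * infsum w (\<phi> ` G) = c * infsum (w \<circ> \<phi>) H"
    using H by (simp add: infsum_reindex)
  also have "\<dots> = (SUP F\<in>{F. finite F \<and> F \<subseteq> H}. c * sum (w \<circ> \<phi>) F)"
    by (subst nonneg_infsum_complete) (auto intro!: SUP_mult_left_ennreal)
  also have "\<dots> \<le> (SUP F\<in>{F. finite F \<and> F \<subseteq> G}. sum v F)"
    using H(1) le by (intro SUP_mono) (auto simp: sum_distrib_left intro!: sum_mono)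
  also have "\<dots> = infsum v G"
    by (subst nonneg_infsum_complete) auto
  finally show ?thesis .
qed

text \<open>Common mechanism of both comparisons: \<phi> sends a cover of \<open>Z\<close> by
  strings for \<open>f\<close> to one for \<open>g\<close>, because the sets of the strings only
  grow, and the total weight grows at most by the factor \<open>1 / c\<close> when \<open>c\<close>
  is positive.\<close>

lemma M_theta_le:
  assumes \<phi>: "\<And>\<s> n. n \<in> admissible_lengths N \<theta> \<Longrightarrow> \<s> \<in> strings \<U> n \<Longrightarrow>
      length (\<phi> \<s>) \<in> admissible_lengths N' \<theta> \<and> set (\<phi> \<s>) \<subseteq> \<V> \<and>
      string_set f \<s> \<subseteq> string_set g (\<phi> \<s>) \<and>
      c * exp (- \<beta> * real (length (\<phi> \<s>))) \<le> exp (- \<alpha> * real (length \<s>))"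
    and c: "0 \<le> c"
  shows "ennreal c * M_theta g Z \<beta> \<V> N' \<theta> \<le> M_theta f Z \<alpha> \<U> N \<theta>"
  unfolding M_theta_def[of f]
proof (rule INF_greatest)
  fix G assume "G \<in> string_covers f Z \<U> N \<theta>"
  then have G: "countable G" "G \<subseteq> (\<Union>n\<in>admissible_lengths N \<theta>. strings \<U> n)"
      "Z \<subseteq> (\<Union>\<s>\<in>G. string_set f \<s>)"
    by (auto simp: string_covers_def)
  have \<phi>': "length (\<phi> \<s>) \<in> admissible_lengths N' \<theta>" "set (\<phi> \<s>) \<subseteq> \<V>"
      "string_set f \<s> \<subseteq> string_set g (\<phi> \<s>)"
      "c * exp (- \<beta> * real (length (\<phi> \<s>))) \<le> exp (- \<alpha> * real (length \<s>))" if "\<s> \<in> G" for \<s>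
    using G(2) that \<phi> by blast+
  have "\<phi> ` G \<in> string_covers g Z \<V> N' \<theta>"
    unfolding string_covers_def mem_Collect_eq
  proof (intro conjI)
    show "\<phi> ` G \<subseteq> (\<Union>n\<in>admissible_lengths N' \<theta>. strings \<V> n)"
      using \<phi>' by (auto simp: strings_def)
    show "Z \<subseteq> (\<Union>\<s>\<in>\<phi> ` G. string_set g \<s>)"
      using G(3) \<phi>'(3) by blast
  qed (use G(1) in auto)
  then have "M_theta g Z \<beta> \<V> N' \<theta> \<le> (\<Sum>\<^sub>\<infinity>\<s>\<in>\<phi> ` G. ennreal (exp (- \<beta> * real (length \<s>))))"
    unfolding M_theta_def by (rule INF_lower)
  then have "ennreal c * M_theta g Z \<beta> \<V> N' \<theta>
      \<le> ennreal c * (\<Sum>\<^sub>\<infinity>\<s>\<in>\<phi> ` G. ennreal (exp (- \<beta> * real (length \<s>))))"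
    by (rule mult_left_mono) simp
  also have "\<dots> \<le> (\<Sum>\<^sub>\<infinity>\<s>\<in>G. ennreal (exp (- \<alpha> * real (length \<s>))))"
    using \<phi>'(4) c by (intro infsum_image_le) (auto simp: ennreal_mult'[symmetric] ennreal_leI)
  finally show "ennreal c * M_theta g Z \<beta> \<V> N' \<theta>
      \<le> (\<Sum>\<^sub>\<infinity>\<s>\<in>G. ennreal (exp (- \<alpha> * real (length \<s>))))" .
qed

section \<open>From strings for \<open>f\<close> to strings for \<open>f^m\<close>: sampling every
  \<open>m\<close>-th entry\<close>

text \<open>For positive \<open>m\<close>, \<open>(N + m - 1) div m\<close> is the ceiling of N/m in
  natural-number arithmetic.\<close>

lemma le_ceil_div_mult:
  fixes m :: nat
  assumes "m \<ge> 1"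
  shows "N \<le> (N + m - 1) div m * m"
  using assms div_mult_mod_eq[of "N + m - 1" m] mod_less_divisor[of m "N + m - 1"] by linarith

text \<open>Ensures that the sampled positions 0, m, 2m, ... stay inside a string of length
  \<open>l\<close>.\<close>

lemma mult_less_if_less_ceil_div:
  fixes m :: nat
  assumes "m \<ge> 1" "j < (l + m - 1) div m"
  shows "j * m < l"
proof -
  have "Suc j * m \<le> l + m - 1"
    using assms(2) by (metis Suc_leI div_times_less_eq_dividend le_trans mult_le_mono1)
  then show ?thesis using assms(1) by simp
qed

text \<open>Rounding up costs at most m - 1, and l < N/\<theta> + 1, so m times the new length is
  below N/\<theta> + m. The \<open>+ 1\<close> of the new window, multiplied by \<open>m\<close>,
  absorbs exactly this extra \<open>m\<close>.\<close>

lemma admissible_lengths_ceil_div: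
  assumes "m \<ge> 1" "0 \<le> \<theta>" and l: "l \<in> admissible_lengths N \<theta>"
  shows "(l + m - 1) div m \<in> admissible_lengths ((N + m - 1) div m) \<theta>"
proof -
  have "(N + m - 1) div m \<le> (l + m - 1) div m"
    using l by (intro div_le_mono) (auto simp: admissible_lengths_def)
  moreover have "real ((l + m - 1) div m) < real ((N + m - 1) div m) / \<theta> + 1" if "\<theta> \<noteq> 0"
  proof -
    have "\<theta> > 0" using that assms by simp
    have "(l + m - 1) div m * m \<le> l + m - 1" by simp
    then have "real ((l + m - 1) div m * m) \<le> real (l + m - 1)" by (rule of_nat_mono)
    then have 1: "real ((l + m - 1) div m) * real m \<le> real l + real m - 1"
      using assms(1) by simp
    have "real N \<le> real ((N + m - 1) div m * m)"
      using le_ceil_div_mult[OF assms(1)] by (rule of_nat_mono)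
    then have "real N / \<theta> \<le> real ((N + m - 1) div m) * real m / \<theta>"
      using \<open>\<theta> > 0\<close> by (simp add: divide_right_mono)
    moreover have "real l < real N / \<theta> + 1"
      using l that by (auto simp: admissible_lengths_def)
    ultimately have "real ((l + m - 1) div m) * real m
        < (real ((N + m - 1) div m) / \<theta> + 1) * real m"
      using 1 by (simp add: algebra_simps)
    then show ?thesis by (simp add: mult_less_cancel_right)
  qed
  ultimately show ?thesis by (auto simp: admissible_lengths_def)
qed

lemma M_theta_power_seq_le:
  assumes m: "m \<ge> 1" and \<theta>: "0 \<le> \<theta>" and \<alpha>: "0 \<le> \<alpha>"
  shows "M_theta (power_seq f m) Z (real m * \<alpha>) \<U> ((N + m - 1) div m) \<theta> \<le> M_theta f Z \<alpha> \<U> N \<theta>"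
proof -
  \<comment> \<open>Entry \<open>j * m\<close> of the string constrains the iterate of
    \<open>f\<close> at time \<open>j * m\<close>, which is the \<open>j\<close>-th iterate of the
    power sequence.\<close>
  define \<phi> where "\<phi> \<s> = map (\<lambda>j. \<s> ! (j * m)) [0..<(length \<s> + m - 1) div m]" for \<s> :: "'a set list"
  have "ennreal 1 * M_theta (power_seq f m) Z (real m * \<alpha>) \<U> ((N + m - 1) div m) \<theta>
      \<le> M_theta f Z \<alpha> \<U> N \<theta>"
  proof (rule M_theta_le[where \<phi> = \<phi>], intro conjI)
    fix \<s> n assume n: "n \<in> admissible_lengths N \<theta>" and s: "\<s> \<in> strings \<U> n"
    show "length (\<phi> \<s>) \<in> admissible_lengths ((N + m - 1) div m) \<theta>"
      using admissible_lengths_ceil_div[OF m \<theta> n] s by (simp add: \<phi>_def strings_def)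
    show "set (\<phi> \<s>) \<subseteq> \<U>"
      using s mult_less_if_less_ceil_div[OF m] by (force simp: \<phi>_def strings_def)
    show "string_set f \<s> \<subseteq> string_set (power_seq f m) (\<phi> \<s>)"
      using mult_less_if_less_ceil_div[OF m]
      by (auto simp: \<phi>_def string_set_def comp_iter_power_seq simp del: One_nat_def)
    \<comment> \<open>Rounding up makes \<open>m\<close> times the new length at least the old one,
      so no weight increases and the constant 1 suffices.\<close>
    have "real (length \<s>) \<le> real m * real (length (\<phi> \<s>))"
      using le_ceil_div_mult[OF m, of "length \<s>"]
      unfolding \<phi>_def by (simp flip: of_nat_mult add: mult.commute)
    then have "\<alpha> * real (length \<s>) \<le> \<alpha> * (real m * real (length (\<phi> \<s>)))"
      using \<alpha> by (rule mult_left_mono)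
    then show "1 * exp (- (real m * \<alpha>) * real (length (\<phi> \<s>))) \<le> exp (- \<alpha> * real (length \<s>))"
      by (simp add: algebra_simps)
  qed simp
  then show ?thesis by simp
qed

section \<open>Covers whose images under short iterates refine a given cover\<close>

lemma equicontinuous_comp_iter:
  assumes f: "equicontinuous_seq f" and "\<epsilon> > 0"
  obtains \<delta> where "\<delta> > 0"
    "\<And>x y i j. dist x y < \<delta> \<Longrightarrow> i \<ge> 1 \<Longrightarrow> j < m \<Longrightarrow>
       dist (comp_iter f i j x) (comp_iter f i j y) < \<epsilon>"
proof -
  have one: "\<exists>\<delta>>0. \<forall>x y i. dist x y < \<delta> \<longrightarrow> i \<ge> 1 \<longrightarrow>
      dist (comp_iter f i j x) (comp_iter f i j y) < \<epsilon>" for j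
    using \<open>\<epsilon> > 0\<close>
  proof (induction j arbitrary: \<epsilon>)
    case (Suc j)
    \<comment> \<open>\<eta> handles the outermost map \<open>f (i + j)\<close> uniformly in its
      index; the induction hypothesis is then used with \<eta> as its tolerance.\<close>
    obtain \<eta> where \<eta>: "\<eta> > 0" "\<And>x y i. dist x y < \<eta> \<Longrightarrow> i \<ge> 1 \<Longrightarrow> dist (f i x) (f i y) < \<epsilon>"
      using f Suc.prems unfolding equicontinuous_seq_def by meson
    obtain \<delta> where "\<delta> > 0" "\<forall>x y i. dist x y < \<delta> \<longrightarrow> i \<ge> 1 \<longrightarrow>
        dist (comp_iter f i j x) (comp_iter f i j y) < \<eta>"
      using Suc.IH[OF \<eta>(1)] by blast
    then show ?case using \<eta> by (intro exI[of _ \<delta>]) auto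
  qed auto
  then obtain d where d: "\<And>j. d j > 0" "\<And>j x y i. dist x y < d j \<Longrightarrow> i \<ge> 1 \<Longrightarrow>
      dist (comp_iter f i j x) (comp_iter f i j y) < \<epsilon>"
    by metis
  show thesis
  proof (rule that)
    \<comment> \<open>Inserting 1 keeps the set nonempty when \<open>m = 0\<close>.\<close>
    show "Min (insert 1 (d ` {..<m})) > 0" using d(1) by simp
    show "dist (comp_iter f i j x) (comp_iter f i j y) < \<epsilon>"
      if "dist x y < Min (insert 1 (d ` {..<m}))" "i \<ge> 1" "j < m" for x y i j
      using that d(2) by simp
  qed
qed

text \<open>A single finite cover has to serve the infinitely many starting indices
  \<open>i\<close>; this works because the \<delta> from equicontinuity is uniform in
  \<open>i\<close>.\<close>

lemma finite_open_cover_refines_comp_iter: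
  fixes f :: "nat \<Rightarrow> 'a::metric_space \<Rightarrow> 'a"
  assumes X: "compact (UNIV :: 'a set)" and f: "equicontinuous_seq f" and \<U>: "finite_open_cover \<U>"
  obtains \<V> where "finite_open_cover \<V>"
    "\<And>V i j. V \<in> \<V> \<Longrightarrow> i \<ge> 1 \<Longrightarrow> j < m \<Longrightarrow> \<exists>U\<in>\<U>. comp_iter f i j ` V \<subseteq> U"
proof -
  \<comment> \<open>\<epsilon> is a Lebesgue number of the cover.\<close>
  obtain \<epsilon> where \<epsilon>: "\<epsilon> > 0" "\<And>x. \<exists>U\<in>\<U>. ball x \<epsilon> \<subseteq> U"
    using Heine_Borel_lemma[OF X, of \<U>] \<U> unfolding finite_open_cover_def by auto
  obtain \<delta> where \<delta>: "\<delta> > 0" "\<And>x y i j. dist x y < \<delta> \<Longrightarrow> i \<ge> 1 \<Longrightarrow> j < m \<Longrightarrow>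
       dist (comp_iter f i j x) (comp_iter f i j y) < \<epsilon>"
    using equicontinuous_comp_iter[OF f \<epsilon>(1)] by metis
  have "(UNIV :: 'a set) \<subseteq> (\<Union>c\<in>UNIV. ball c \<delta>)" using \<delta>(1) by (auto intro: centre_in_ball[THEN iffD2])
  then obtain C where C: "finite C" "(UNIV :: 'a set) \<subseteq> (\<Union>c\<in>C. ball c \<delta>)"
    by (rule compactE_image[OF X open_ball])
  show thesis
  proof (rule that)
    show "finite_open_cover ((\<lambda>c. ball c \<delta>) ` C)"
      using C by (auto simp: finite_open_cover_def)
    show "\<exists>U\<in>\<U>. comp_iter f i j ` V \<subseteq> U"
      if V: "V \<in> (\<lambda>c. ball c \<delta>) ` C" and ij: "i \<ge> 1" "j < m" for V i j
    proof -
      obtain c where c: "V = ball c \<delta>" using V by auto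
      have "comp_iter f i j ` V \<subseteq> ball (comp_iter f i j c) \<epsilon>"
        using \<delta>(2)[OF _ ij] by (auto simp: c)
      then show ?thesis using \<epsilon>(2) by (meson subset_trans)
    qed
  qed
qed

section \<open>From strings for \<open>f^m\<close> to strings for \<open>f\<close>: expanding and
  truncating\<close>

text \<open>For nonzero \<theta> the expanded length \<open>n * m\<close> exceeds N/\<theta> by less
  than m/\<theta> + m, since rounding N/m up adds at most \<open>m\<close> to \<open>N\<close>.
  Removing \<open>K\<close> entries therefore fits the window, and the maximum with \<open>N\<close>
  protects its lower end. For \<theta> = 0 there is no upper end, so any \<open>K\<close> will
  do.\<close>

lemma admissible_lengths_truncate:
  assumes m: "m \<ge> 1" and \<theta>: "0 \<le> \<theta>" "\<theta> \<le> 1"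
    and n: "n \<in> admissible_lengths ((N + m - 1) div m) \<theta>"
    and K: "\<theta> \<noteq> 0 \<Longrightarrow> real m / \<theta> + real m \<le> real K"
  shows "max N (n * m - K) \<in> admissible_lengths N \<theta>" "max N (n * m - K) \<le> n * m"
proof -
  define N' where "N' = (N + m - 1) div m"
  have N'_le: "N' * m \<le> N + m" unfolding N'_def
    by (rule order_trans[OF div_times_less_eq_dividend]) simp
  have le_N': "N \<le> N' * m" unfolding N'_def
    by (rule le_ceil_div_mult[OF m])
  have n': "N' \<le> n" "\<theta> \<noteq> 0 \<Longrightarrow> real n < real N' / \<theta> + 1"
    using n by (auto simp: admissible_lengths_def N'_def)
  have "N \<le> n * m" using le_N' n'(1) by (meson le_trans mult_le_mono1)
  then show "max N (n * m - K) \<le> n * m" by simp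
  have "real (max N (n * m - K)) < real N / \<theta> + 1" if "\<theta> \<noteq> 0"
  proof -
    have pos: "\<theta> > 0" using that \<theta> by simp
    \<comment> \<open>Here \<theta> \<le> 1 enters: the length \<open>N\<close> itself lies in the
      window.\<close>
    have "real N \<le> real N / \<theta>"
      using pos \<theta>(2) by (simp add: pos_le_divide_eq mult_left_le)
    moreover have "real (n * m - K) < real N / \<theta> + 1"
    proof (cases "n * m \<le> K")
      case True
      then show ?thesis using pos by (simp add: add_nonneg_pos)
    next
      case False
      have "real n * real m < (real N' / \<theta> + 1) * real m"
        using n'(2)[OF that] m by simp
      also have "\<dots> = real (N' * m) / \<theta> + real m" by (simp add: algebra_simps)
      also have "\<dots> \<le> real (N + m) / \<theta> + real m"
        using pos of_nat_mono[OF N'_le, where 'a = real] by (intro add_right_mono divide_right_mono) auto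
      also have "\<dots> \<le> real N / \<theta> + real K" using K[OF that] by (simp add: add_divide_distrib)
      finally show ?thesis using False by (simp add: of_nat_diff)
    qed
    ultimately show ?thesis by (auto simp: max_def)
  qed
  then show "max N (n * m - K) \<in> admissible_lengths N \<theta>" by (auto simp: admissible_lengths_def)
qed

lemma M_theta_le_power_seq:
  fixes f :: "nat \<Rightarrow> 'a \<Rightarrow> 'a"
  assumes m: "m \<ge> 1" and \<theta>: "0 \<le> \<theta>" "\<theta> \<le> 1" and \<alpha>: "0 \<le> \<alpha>"
    and K: "\<theta> \<noteq> 0 \<Longrightarrow> real m / \<theta> + real m \<le> real K"
    and ref: "\<And>V i j. V \<in> \<V> \<Longrightarrow> i \<ge> 1 \<Longrightarrow> j < m \<Longrightarrow> \<exists>U\<in>\<U>. comp_iter f i j ` V \<subseteq> U"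
  shows "ennreal (exp (- \<alpha> * real K)) * M_theta f Z \<alpha> \<U> N \<theta>
    \<le> M_theta (power_seq f m) Z (real m * \<alpha>) \<V> ((N + m - 1) div m) \<theta>"
proof -
  \<comment> \<open>\<open>u V i j\<close> selects a member of the cover that contains the image of
    \<open>V\<close>.\<close>
  obtain u where u: "\<And>V i j. V \<in> \<V> \<Longrightarrow> i \<ge> 1 \<Longrightarrow> j < m \<Longrightarrow>
      u V i j \<in> \<U> \<and> comp_iter f i j ` V \<subseteq> u V i j"
    using ref by metis
  \<comment> \<open>Time \<open>k\<close> lies in block \<open>k div m\<close> at offset
    \<open>k mod m\<close>. The block's entry of \<open>t\<close> locates the orbit at the start of
    the block, and \<open>u\<close> carries this information forward to the offset.\<close>
  define \<phi> where "\<phi> t = map (\<lambda>k. u (t ! (k div m)) (1 + k div m * m) (k mod m))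
      [0..<max N (length t * m - K)]" for t :: "'a set list"
  show ?thesis
  proof (rule M_theta_le[where \<phi> = \<phi>], intro conjI)
    fix t n assume n: "n \<in> admissible_lengths ((N + m - 1) div m) \<theta>" and t: "t \<in> strings \<V> n"
    have len: "length t = n" and tV: "set t \<subseteq> \<V>" using t by (auto simp: strings_def)
    note trunc = admissible_lengths_truncate[OF m \<theta> n K]
    show "length (\<phi> t) \<in> admissible_lengths N \<theta>"
      using trunc(1) by (simp add: \<phi>_def len)
    have k: "k div m < n" "t ! (k div m) \<in> \<V>" "k mod m < m" if "k < max N (n * m - K)" for k
    proof -
      have "k < n * m" using that trunc(2) by linarith
      then show "k div m < n" by (simp add: less_mult_imp_div_less)
      then show "t ! (k div m) \<in> \<V>" using tV len nth_mem by blast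
      show "k mod m < m" using m by simp
    qed
    show "set (\<phi> t) \<subseteq> \<U>"
      using u[OF k(2) _ k(3)] by (auto simp: \<phi>_def len)
    show "string_set (power_seq f m) t \<subseteq> string_set f (\<phi> t)"
    proof
      fix x assume x: "x \<in> string_set (power_seq f m) t"
      have "comp_iter f 1 k x \<in> u (t ! (k div m)) (1 + k div m * m) (k mod m)"
        if "k < max N (n * m - K)" for k
      proof -
        have "comp_iter f 1 (k div m * m) x \<in> t ! (k div m)"
          using x k(1)[OF that] unfolding string_set_def comp_iter_power_seq by (simp add: len)
        moreover have "comp_iter f 1 k =
            comp_iter f (1 + k div m * m) (k mod m) \<circ> comp_iter f 1 (k div m * m)"
          using comp_iter_add[of f 1 "k div m * m" "k mod m"] by simp
        ultimately show ?thesis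
          using u[OF k(2)[OF that] _ k(3)[OF that], of "1 + k div m * m"] by auto
      qed
      then show "x \<in> string_set f (\<phi> t)"
        by (simp add: string_set_def \<phi>_def len)
    qed
    \<comment> \<open>At most \<open>K\<close> entries are lost, so each weight grows at most by the
      factor e^(\<alpha> K).\<close>
    have "n * m \<le> max N (n * m - K) + K" by linarith
    from of_nat_mono[OF this, where 'a = real]
    have "real n * real m \<le> real (max N (n * m - K)) + real K" 
      by (simp only: of_nat_add of_nat_mult)
    then have "\<alpha> * (real n * real m) \<le> \<alpha> * (real (max N (n * m - K)) + real K)"
      using \<alpha> by (rule mult_left_mono)
    then show "exp (- \<alpha> * real K) * exp (- \<alpha> * real (length (\<phi> t)))
        \<le> exp (- (real m * \<alpha>) * real (length t))"
      by (simp add: \<phi>_def len algebra_simps flip: exp_add)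
  qed simp
qed

section \<open>Limits along the reparametrisation of \<open>N\<close>\<close>

text \<open>The ceiling of N/m tends to infinity and also attains every value. Thus limits inferior
  and superior along it are those of the whole sequence, not merely of a subsequence.\<close>

lemma filtermap_ceil_div_sequentially:
  fixes m :: nat
  assumes m: "m \<ge> 1"
  shows "filtermap (\<lambda>N. (N + m - 1) div m) sequentially = sequentially"
proof (rule antisym)
  have "N \<le> (k + m - 1) div m" if "N * m \<le> k" for N k
  proof -
    have "N * m div m \<le> (k + m - 1) div m" using that m by (intro div_le_mono) linarith
    then show ?thesis using m by simp
  qed
  then have "\<forall>\<^sub>F k in sequentially. N \<le> (k + m - 1) div m" for N
    unfolding eventually_sequentially by blast
  then show "filtermap (\<lambda>N. (N + m - 1) div m) sequentially \<le> sequentially"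
    using filterlim_at_top unfolding filterlim_def by blast
  show "sequentially \<le> filtermap (\<lambda>N. (N + m - 1) div m) sequentially"
  proof (rule filter_leI)
    fix P assume "eventually P (filtermap (\<lambda>N. (N + m - 1) div m) sequentially)"
    then obtain k where k: "\<And>N. N \<ge> k \<Longrightarrow> P ((N + m - 1) div m)"
      unfolding eventually_filtermap eventually_sequentially by blast
    \<comment> \<open>The value \<open>N\<close> is attained at the argument \<open>N * m\<close>,
      which is at least \<open>k\<close>.\<close>
    have "P N" if "N \<ge> k" for N
    proof -
      have "N * m + m - 1 = (m - 1) + N * m" using m by simp
      then have "(N * m + m - 1) div m = N"
        using m by (simp only: div_mult_self1) simp
      moreover have "k \<le> N * m" using that m by (metis le_trans mult.right_neutral mult_le_mono2)
      ultimately show ?thesis using k by metis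
    qed
    then show "eventually P sequentially" unfolding eventually_sequentially by blast
  qed
qed


text \<open>In a complete linear order a lower bound of a limit inferior is characterised by
  eventual strict inequalities, and these pull back along \<open>c\<close>; both sides thus have the
  same lower bounds.\<close>

lemma Liminf_filtermap_linorder:
  fixes g :: "_ \<Rightarrow> 'b :: complete_linorder"
  shows "Liminf (filtermap c F) g = Liminf F (\<lambda>x. g (c x))"
proof -
  have "C \<le> Liminf (filtermap c F) g \<longleftrightarrow> C \<le> Liminf F (\<lambda>x. g (c x))" for C
    by (simp add: le_Liminf_iff eventually_filtermap)
  then show ?thesis by (meson antisym order_refl)
qed

lemma Limsup_filtermap_linorder:
  fixes g :: "_ \<Rightarrow> 'b :: complete_linorder"
  shows "Limsup (filtermap c F) g = Limsup F (\<lambda>x. g (c x))"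
proof -
  have "Limsup (filtermap c F) g \<le> C \<longleftrightarrow> Limsup F (\<lambda>x. g (c x)) \<le> C" for C
    by (simp add: Limsup_le_iff eventually_filtermap)
  then show ?thesis by (meson antisym order_refl)
qed

lemma liminf_ceil_div:
  fixes g :: "nat \<Rightarrow> ennreal"
  assumes "m \<ge> 1"
  shows "liminf (\<lambda>N. g ((N + m - 1) div m)) = liminf g"
  using Liminf_filtermap_linorder[of "\<lambda>N. (N + m - 1) div m" sequentially g]
    filtermap_ceil_div_sequentially[OF assms] by simp

lemma limsup_ceil_div:
  fixes g :: "nat \<Rightarrow> ennreal"
  assumes "m \<ge> 1"
  shows "limsup (\<lambda>N. g ((N + m - 1) div m)) = limsup g"
  using Limsup_filtermap_linorder[of "\<lambda>N. (N + m - 1) div m" sequentially g]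
    filtermap_ceil_div_sequentially[OF assms] by simp

text \<open>Multiplication by a finite constant is continuous and monotone on
  \<open>ennreal\<close>, so it commutes with both limits; a nonzero constant then cancels from an
  equation with 0.\<close>

lemma Liminf_Limsup_eq_0_if_cmult_le:
  fixes a b :: "nat \<Rightarrow> ennreal"
  assumes le: "\<forall>\<^sub>F N in sequentially. ennreal c * a N \<le> b N" and c: "c > 0"
  shows "liminf b = 0 \<Longrightarrow> liminf a = 0" and "limsup b = 0 \<Longrightarrow> limsup a = 0"
proof -
  have cont: "continuous_on UNIV (\<lambda>x. ennreal c * x)"
    by (intro ennreal_continuous_on_cmult continuous_on_id) simp
  have mono: "mono (\<lambda>x. ennreal c * x)" by (auto intro!: monoI mult_left_mono)
  have "ennreal c * liminf a \<le> liminf b"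
    using Liminf_mono[OF le]
    by (simp add: Liminf_compose_continuous_mono[OF cont mono sequentially_bot])
  then show "liminf b = 0 \<Longrightarrow> liminf a = 0" using c by simp
  have "ennreal c * limsup a \<le> limsup b"
    using Limsup_mono[OF le]
    by (simp add: Limsup_compose_continuous_mono[OF cont mono sequentially_bot])
  then show "limsup b = 0 \<Longrightarrow> limsup a = 0" using c by simp
qed

section \<open>Critical exponents relative to a cover\<close>

text \<open>The exponent becomes \<open>real m * \<alpha>\<close> because one step of the power
  sequence takes \<open>m\<close> steps of \<open>f\<close>.\<close>

lemma lower_upper_m_power_seq_eq_0:
  assumes m: "m \<ge> 1" and \<theta>: "0 \<le> \<theta>" and \<alpha>: "0 \<le> \<alpha>"
  shows "lower_m f Z \<alpha> \<U> \<theta> = 0 \<Longrightarrow> lower_m (power_seq f m) Z (real m * \<alpha>) \<U> \<theta> = 0"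
    and "upper_m f Z \<alpha> \<U> \<theta> = 0 \<Longrightarrow> upper_m (power_seq f m) Z (real m * \<alpha>) \<U> \<theta> = 0"
proof -
  have "\<forall>\<^sub>F N in sequentially.
      ennreal 1 * M_theta (power_seq f m) Z (real m * \<alpha>) \<U> ((N + m - 1) div m) \<theta> \<le> M_theta f Z \<alpha> \<U> N \<theta>"
    using M_theta_power_seq_le[OF m \<theta> \<alpha>, of f Z \<U>] by simp
  note null = Liminf_Limsup_eq_0_if_cmult_le[OF this zero_less_one]
  show "lower_m f Z \<alpha> \<U> \<theta> = 0 \<Longrightarrow> lower_m (power_seq f m) Z (real m * \<alpha>) \<U> \<theta> = 0"
    using null(1) liminf_ceil_div[OF m, of "\<lambda>N. M_theta (power_seq f m) Z (real m * \<alpha>) \<U> N \<theta>"]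
    by (simp add: lower_m_def)
  show "upper_m f Z \<alpha> \<U> \<theta> = 0 \<Longrightarrow> upper_m (power_seq f m) Z (real m * \<alpha>) \<U> \<theta> = 0"
    using null(2) limsup_ceil_div[OF m, of "\<lambda>N. M_theta (power_seq f m) Z (real m * \<alpha>) \<U> N \<theta>"]
    by (simp add: upper_m_def)
qed

lemma lower_upper_m_eq_0_if_power_seq:
  assumes m: "m \<ge> 1" and \<theta>: "0 \<le> \<theta>" "\<theta> \<le> 1" and \<alpha>: "0 \<le> \<alpha>"
    and ref: "\<And>V i j. V \<in> \<V> \<Longrightarrow> i \<ge> 1 \<Longrightarrow> j < m \<Longrightarrow> \<exists>U\<in>\<U>. comp_iter f i j ` V \<subseteq> U"
  shows "lower_m (power_seq f m) Z (real m * \<alpha>) \<V> \<theta> = 0 \<Longrightarrow> lower_m f Z \<alpha> \<U> \<theta> = 0"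
    and "upper_m (power_seq f m) Z (real m * \<alpha>) \<V> \<theta> = 0 \<Longrightarrow> upper_m f Z \<alpha> \<U> \<theta> = 0"
proof -
  \<comment> \<open>\<open>K\<close> is independent of \<open>N\<close>, so the factor e^(-\<alpha>
    K) is a positive constant in the limit. For \<theta> = 0 the quotient is 0 in HOL, which is
    harmless as the bound on \<open>K\<close> is required only for nonzero \<theta>.\<close>
  obtain K :: nat where K: "real m / \<theta> + real m \<le> real K" using real_arch_simple by blast
  have "ennreal (exp (- \<alpha> * real K)) * M_theta f Z \<alpha> \<U> N \<theta>
      \<le> M_theta (power_seq f m) Z (real m * \<alpha>) \<V> ((N + m - 1) div m) \<theta>" for N
    by (rule M_theta_le_power_seq[OF m \<theta> \<alpha> K ref])
  then have "\<forall>\<^sub>F N in sequentially. ennreal (exp (- \<alpha> * real K)) * M_theta f Z \<alpha> \<U> N \<theta>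
      \<le> M_theta (power_seq f m) Z (real m * \<alpha>) \<V> ((N + m - 1) div m) \<theta>"
    by simp
  note null = Liminf_Limsup_eq_0_if_cmult_le[OF this exp_gt_zero]
  show "lower_m (power_seq f m) Z (real m * \<alpha>) \<V> \<theta> = 0 \<Longrightarrow> lower_m f Z \<alpha> \<U> \<theta> = 0"
    using null(1) liminf_ceil_div[OF m, of "\<lambda>N. M_theta (power_seq f m) Z (real m * \<alpha>) \<V> N \<theta>"]
    by (simp add: lower_m_def)
  show "upper_m (power_seq f m) Z (real m * \<alpha>) \<V> \<theta> = 0 \<Longrightarrow> upper_m f Z \<alpha> \<U> \<theta> = 0"
    using null(2) limsup_ceil_div[OF m, of "\<lambda>N. M_theta (power_seq f m) Z (real m * \<alpha>) \<V> N \<theta>"]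
    by (simp add: upper_m_def)
qed

text \<open>Each exponent \<beta> satisfying \<open>P\<close> yields \<beta>/c satisfying
  \<open>Q\<close>. If no exponent satisfies \<open>P\<close>, the right-hand infimum is infinite
  and the bound is trivial.\<close>

lemma cmult_INF_ennreal_le:
  assumes c: "c > 0" and imp: "\<And>\<alpha>. 0 \<le> \<alpha> \<Longrightarrow> P (c * \<alpha>) \<Longrightarrow> Q \<alpha>"
  shows "ennreal c * (INF \<alpha>\<in>{\<alpha>. 0 \<le> \<alpha> \<and> Q \<alpha>}. ennreal \<alpha>) \<le> (INF \<alpha>\<in>{\<alpha>. 0 \<le> \<alpha> \<and> P \<alpha>}. ennreal \<alpha>)"
proof (rule INF_greatest)
  fix \<beta> assume "\<beta> \<in> {\<alpha>. 0 \<le> \<alpha> \<and> P \<alpha>}"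
  then have "\<beta> / c \<in> {\<alpha>. 0 \<le> \<alpha> \<and> Q \<alpha>}" using imp[of "\<beta> / c"] c by simp
  then have "ennreal c * (INF \<alpha>\<in>{\<alpha>. 0 \<le> \<alpha> \<and> Q \<alpha>}. ennreal \<alpha>) \<le> ennreal c * ennreal (\<beta> / c)"
    by (intro mult_left_mono INF_lower) auto
  also have "\<dots> = ennreal \<beta>" using c by (simp flip: ennreal_mult')
  finally show "ennreal c * (INF \<alpha>\<in>{\<alpha>. 0 \<le> \<alpha> \<and> Q \<alpha>}. ennreal \<alpha>) \<le> ennreal \<beta>" .
qed

lemma INF_ennreal_le_cmult:
  assumes c: "c > 0" and imp: "\<And>\<alpha>. 0 \<le> \<alpha> \<Longrightarrow> Q \<alpha> \<Longrightarrow> P (c * \<alpha>)"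
  shows "(INF \<alpha>\<in>{\<alpha>. 0 \<le> \<alpha> \<and> P \<alpha>}. ennreal \<alpha>) \<le> ennreal c * (INF \<alpha>\<in>{\<alpha>. 0 \<le> \<alpha> \<and> Q \<alpha>}. ennreal \<alpha>)"
    (is "?P \<le> _ * ?Q")
proof -
  \<comment> \<open>The preceding inequality with \<open>1 / c\<close> for \<open>c\<close> and with
    \<open>P\<close> and \<open>Q\<close> exchanged.\<close>
  have "ennreal (1 / c) * ?P \<le> ?Q"
    using c imp[of "_ / c"] imp by (intro cmult_INF_ennreal_le) (force simp: field_simps)+
  then have "ennreal c * (ennreal (1 / c) * ?P) \<le> ennreal c * ?Q" by (rule mult_left_mono) simp
  also have "ennreal c * (ennreal (1 / c) * ?P) = ?P"
    using c by (simp add: mult.assoc[symmetric] ennreal_mult'[symmetric])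
  finally show ?thesis .
qed

lemma h_cover_power_seq_le:
  assumes "m \<ge> 1" "0 \<le> \<theta>"
  shows "lower_h_cover (power_seq f m) Z \<U> \<theta> \<le> of_nat m * lower_h_cover f Z \<U> \<theta>"
    and "upper_h_cover (power_seq f m) Z \<U> \<theta> \<le> of_nat m * upper_h_cover f Z \<U> \<theta>"
proof -
  have "real m > 0" using assms(1) by simp
  note le = INF_ennreal_le_cmult[OF this]
  show "lower_h_cover (power_seq f m) Z \<U> \<theta> \<le> of_nat m * lower_h_cover f Z \<U> \<theta>"
    unfolding lower_h_cover_def ennreal_of_nat_eq_real_of_nat
    by (rule le) (rule lower_upper_m_power_seq_eq_0(1)[OF assms])
  show "upper_h_cover (power_seq f m) Z \<U> \<theta> \<le> of_nat m * upper_h_cover f Z \<U> \<theta>"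
    unfolding upper_h_cover_def ennreal_of_nat_eq_real_of_nat
    by (rule le) (rule lower_upper_m_power_seq_eq_0(2)[OF assms])
qed

lemma h_cover_le_power_seq:
  assumes "m \<ge> 1" "0 \<le> \<theta>" "\<theta> \<le> 1"
    and ref: "\<And>V i j. V \<in> \<V> \<Longrightarrow> i \<ge> 1 \<Longrightarrow> j < m \<Longrightarrow> \<exists>U\<in>\<U>. comp_iter f i j ` V \<subseteq> U"
  shows "of_nat m * lower_h_cover f Z \<U> \<theta> \<le> lower_h_cover (power_seq f m) Z \<V> \<theta>"
    and "of_nat m * upper_h_cover f Z \<U> \<theta> \<le> upper_h_cover (power_seq f m) Z \<V> \<theta>"
proof -
  have "real m > 0" using assms(1) by simp
  note le = cmult_INF_ennreal_le[OF this]
  show "of_nat m * lower_h_cover f Z \<U> \<theta> \<le> lower_h_cover (power_seq f m) Z \<V> \<theta>"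
    unfolding lower_h_cover_def ennreal_of_nat_eq_real_of_nat
    by (rule le) (rule lower_upper_m_eq_0_if_power_seq(1)[OF assms(1-3) _ ref])
  show "of_nat m * upper_h_cover f Z \<U> \<theta> \<le> upper_h_cover (power_seq f m) Z \<V> \<theta>"
    unfolding upper_h_cover_def ennreal_of_nat_eq_real_of_nat
    by (rule le) (rule lower_upper_m_eq_0_if_power_seq(2)[OF assms(1-3) _ ref])
qed

section \<open>Suprema over all finite open covers\<close>

theorem proposition3p4:
  fixes f :: "nat \<Rightarrow> 'a::metric_space \<Rightarrow> 'a"
    and Z :: "'a set" and \<theta> :: real and m :: nat
  assumes "compact (UNIV :: 'a set)"
    and "equicontinuous_seq f"
    and "\<theta> \<in> {0..1}"
    and "m \<ge> 1"
  shows "lower_h_top (power_seq f m) Z \<theta> = of_nat m * lower_h_top f Z \<theta> \<and>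
         upper_h_top (power_seq f m) Z \<theta> = of_nat m * upper_h_top f Z \<theta>"
proof -
  have \<theta>: "0 \<le> \<theta>" "\<theta> \<le> 1" using assms(3) by auto
  \<comment> \<open>The lower bound for \<open>f^m\<close> passes to another cover, so it is
    compared cover by cover only up to refinement; the supremum absorbs the change. In the opposite
    direction the same cover serves on both sides.\<close>
  have refine: "\<exists>\<V>\<in>{\<V>. finite_open_cover \<V>}.
      of_nat m * lower_h_cover f Z \<U> \<theta> \<le> lower_h_cover (power_seq f m) Z \<V> \<theta> \<and>
      of_nat m * upper_h_cover f Z \<U> \<theta> \<le> upper_h_cover (power_seq f m) Z \<V> \<theta>"
    if \<U>: "finite_open_cover \<U>" for \<U>
  proof -
    obtain \<V> where \<V>: "finite_open_cover \<V>"
      "\<And>V i j. V \<in> \<V> \<Longrightarrow> i \<ge> 1 \<Longrightarrow> j < m \<Longrightarrow> \<exists>U\<in>\<U>. comp_iter f i j ` V \<subseteq> U"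
      using finite_open_cover_refines_comp_iter[OF assms(1,2) \<U>] by metis
    then show ?thesis using h_cover_le_power_seq[OF assms(4) \<theta>, of \<V> \<U> f Z] by blast
  qed
  show ?thesis
  proof (intro conjI antisym)
    show "lower_h_top (power_seq f m) Z \<theta> \<le> of_nat m * lower_h_top f Z \<theta>"
      unfolding lower_h_top_def SUP_mult_left_ennreal
      using h_cover_power_seq_le(1)[OF assms(4) \<theta>(1)] by (intro SUP_mono) blast
    show "upper_h_top (power_seq f m) Z \<theta> \<le> of_nat m * upper_h_top f Z \<theta>"
      unfolding upper_h_top_def SUP_mult_left_ennreal
      using h_cover_power_seq_le(2)[OF assms(4) \<theta>(1)] by (intro SUP_mono) blast
    show "of_nat m * lower_h_top f Z \<theta> \<le> lower_h_top (power_seq f m) Z \<theta>"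
      unfolding lower_h_top_def SUP_mult_left_ennreal
      using refine by (intro SUP_mono) blast
    show "of_nat m * upper_h_top f Z \<theta> \<le> upper_h_top (power_seq f m) Z \<theta>"
      unfolding upper_h_top_def SUP_mult_left_ennreal
      using refine by (intro SUP_mono) blast
  qed
qed

end
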